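(* A smooth real symmetric cubic surface contains either exactly $3$ or exactly $27$ real lines, and both of these possibilities do occur.
   Context: A real symmetric cubic surface is $V(F)$ with $F\in\mathbb R[x_0,x_1,x_2,x_3]$ homogeneous of degree $3$ and symmetric under all permutations of the variables. Smooth means that the complex surface $V(F)\subset\mathbb{CP}^3$ is smooth. A real line is a line on the surface that is defined over $\mathbb R$. *)

theory Defs
  imports "HOL-Analysis.Analysis" "HOL-Library.Poly_Mapping" "HOL-Library.Numeral_Type"
begin

text \<open>A polynomial in the variables \<open>x\<^sub>0, x\<^sub>1, x\<^sub>2, x\<^sub>3\<close> is a finitely supported map from
  exponent vectors to coefficients; the index type \<open>4\<close> has the elements \<open>0, 1, 2, 3\<close>.\<close>

type_synonym 'a poly4 = "(4 \<Rightarrow>\<^sub>0 nat) \<Rightarrow>\<^sub>0 'a"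

definition eval4 :: "'a::comm_ring_1 poly4 \<Rightarrow> 'a ^ 4 \<Rightarrow> 'a" where
  "eval4 F x = (\<Sum>m\<in>Poly_Mapping.keys F.
     Poly_Mapping.lookup F m * (\<Prod>i\<in>UNIV. (x $ i) ^ Poly_Mapping.lookup m i))"

definition partial4 :: "4 \<Rightarrow> 'a::comm_ring_1 poly4 \<Rightarrow> 'a poly4" where
  "partial4 i F = (\<Sum>m\<in>Poly_Mapping.keys F.
     Poly_Mapping.single (m - Poly_Mapping.single i 1)
       (of_nat (Poly_Mapping.lookup m i) * Poly_Mapping.lookup F m))"

definition homogeneous4 :: "nat \<Rightarrow> 'a::comm_ring_1 poly4 \<Rightarrow> bool" where
  "homogeneous4 d F \<longleftrightarrow>
     (\<forall>m\<in>Poly_Mapping.keys F. (\<Sum>i\<in>UNIV. Poly_Mapping.lookup m i) = d)"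

text \<open>The exponent vector \<open>Poly_Mapping.map_key \<pi> m\<close> is \<open>i \<mapsto> m (\<pi> i)\<close>, so invariance of the
  coefficients below is invariance of the polynomial under permutation of the variables.\<close>

definition symmetric4 :: "'a::comm_ring_1 poly4 \<Rightarrow> bool" where
  "symmetric4 F \<longleftrightarrow> (\<forall>\<pi> :: 4 \<Rightarrow> 4. bij \<pi> \<longrightarrow>
     (\<forall>m. Poly_Mapping.lookup F (Poly_Mapping.map_key \<pi> m) = Poly_Mapping.lookup F m))"

definition complexify4 :: "real poly4 \<Rightarrow> complex poly4" where
  "complexify4 F = Poly_Mapping.map complex_of_real F"

text \<open>Points of \<open>\<complex>P\<^sup>3\<close> are the one-dimensional complex subspaces of \<open>\<complex>\<^sup>4\<close>
  (\<open>vec.subspace\<close> and \<open>vec.dim\<close> are taken over the field of entries, here \<open>\<complex>\<close>).\<close>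

definition CP3 :: "(complex ^ 4) set set" where
  "CP3 = {p. vec.subspace p \<and> vec.dim p = 1}"

definition projectivization :: "(complex ^ 4) set \<Rightarrow> (complex ^ 4) set set" where
  "projectivization W = {p \<in> CP3. p \<subseteq> W}"

definition is_line :: "(complex ^ 4) set set \<Rightarrow> bool" where
  "is_line L \<longleftrightarrow> (\<exists>W. vec.subspace W \<and> vec.dim W = 2 \<and> L = projectivization W)"

text \<open>A line is defined over \<open>\<real>\<close> if it is the zero set of linear forms with real coefficients.\<close>

definition real_linear_zeros :: "(real ^ 4) set \<Rightarrow> (complex ^ 4) set" where
  "real_linear_zeros A = {z. \<forall>a\<in>A. (\<Sum>i\<in>UNIV. complex_of_real (a $ i) * z $ i) = 0}"

definition is_real_line :: "(complex ^ 4) set set \<Rightarrow> bool" where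
  "is_real_line L \<longleftrightarrow> is_line L \<and> (\<exists>A. L = projectivization (real_linear_zeros A))"

text \<open>For the homogeneous \<open>F\<close> considered here, vanishing at one nonzero representative of a point
  is the same as vanishing at all of them.\<close>

definition surface :: "real poly4 \<Rightarrow> (complex ^ 4) set set" where
  "surface F = {p \<in> CP3. \<forall>z\<in>p. eval4 (complexify4 F) z = 0}"

text \<open>Smoothness of the hypersurface with equation \<open>F\<close>, with its multiplicities; in particular
  \<open>F = 0\<close> and equations with a repeated factor are not smooth.\<close>

definition smooth_surface :: "real poly4 \<Rightarrow> bool" where
  "smooth_surface F \<longleftrightarrow> (\<forall>p\<in>surface F. \<forall>z\<in>p. z \<noteq> 0 \<longrightarrow>
     (\<exists>i. eval4 (partial4 i (complexify4 F)) z \<noteq> 0))"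

definition smooth_real_symmetric_cubic :: "real poly4 \<Rightarrow> bool" where
  "smooth_real_symmetric_cubic F \<longleftrightarrow>
     homogeneous4 3 F \<and> symmetric4 F \<and> smooth_surface F"

definition real_lines :: "real poly4 \<Rightarrow> (complex ^ 4) set set set" where
  "real_lines F = {L. is_real_line L \<and> L \<subseteq> surface F}"

end

theory Submission
  imports Defs "HOL-Combinatorics.Transposition"
begin

text \<open>A symmetric cubic is a combination \<open>a p\<^sub>1\<^sup>3 + b p\<^sub>1 p\<^sub>2 + c p\<^sub>3\<close> of power sums.  The key
  is to pass to the coordinates in which the Klein four-group of double transpositions is diagonal:
  \<open>t = x\<^sub>1 + x\<^sub>2 + x\<^sub>3 + x\<^sub>4\<close> together with \<open>y\<^sub>1, y\<^sub>2, y\<^sub>3\<close> of the form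
  \<open>x\<^sub>i + x\<^sub>j - x\<^sub>k - x\<^sub>l\<close>.  There the cubic is
  \<open>p t\<^sup>3 + q t (y\<^sub>1\<^sup>2 + y\<^sub>2\<^sup>2 + y\<^sub>3\<^sup>2) + 2 r y\<^sub>1 y\<^sub>2 y\<^sub>3\<close> up to a constant factor, where \<open>q\<close> and
  \<open>r\<close> are nonzero if the surface is smooth, and rescaling \<open>t\<close> leaves the one-parameter family
  \<open>t (y\<^sub>1\<^sup>2 + y\<^sub>2\<^sup>2 + y\<^sub>3\<^sup>2) - m t\<^sup>3 + 2 y\<^sub>1 y\<^sub>2 y\<^sub>3 = 0\<close>  (lemma \<open>cubic_hadamard\<close>).
  The value \<open>m = 1\<close> gives a surface with a node and is excluded by smoothness
  (lemma \<open>smooth_cubic_nondegenerate\<close>).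

  The plane \<open>t = 0\<close> cuts out the three lines \<open>t = y\<^sub>i = 0\<close>, all real.  Any other line meets that
  plane in a point of one of these three, say with \<open>y\<^sub>a = 0\<close>, and hence lies in a plane
  \<open>y\<^sub>a = \<alpha> t\<close>.  In such a plane the residual conic is
  \<open>y\<^sub>b\<^sup>2 + 2 \<alpha> y\<^sub>b y\<^sub>c + y\<^sub>c\<^sup>2 + (\<alpha>\<^sup>2 - m) t\<^sup>2 = 0\<close>, which is degenerate only for \<open>\<alpha>\<^sup>2 = m\<close> and
  \<open>\<alpha>\<^sup>2 = 1\<close>.  For \<open>m > 1\<close> each of the resulting four planes contributes two real lines, that is,
  eight for each \<open>a\<close> and \<open>3 + 3 \<cdot> 8 = 27\<close> in all; for \<open>m < 1\<close> no real line other than the first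
  three exists (lemmas \<open>line_params_8\<close>, \<open>line_params_empty\<close> and
  \<open>card_real_planes_normal_cubic\<close>).

  Real lines of \<open>\<complex>P\<^sup>3\<close> on the surface correspond to two-dimensional subspaces of \<open>\<real>\<^sup>4\<close> on which
  the real cubic form vanishes (lemma \<open>card_real_lines\<close>), so that the count takes place over
  \<open>\<real>\<close>.  Both values of the count occur: the Fermat cubic has \<open>m = - 1 / 3\<close> and the Clebsch cubic
  has \<open>m = 5\<close>.\<close>

section \<open>Cubic forms in four variables\<close>

lemma prod_4: "prod f (UNIV::4 set) = f 1 * f 2 * f 3 * f 4"
  for f :: "4 \<Rightarrow> 'a::comm_monoid_mult"
  unfolding UNIV_4 by (simp add: ac_simps)

text \<open>In the index type \<open>4\<close> the numeral \<open>4\<close> denotes the element \<open>0\<close>, so that \<open>1, 2, 3, 4\<close> lists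
  all indices.\<close>

definition expo :: "nat \<Rightarrow> nat \<Rightarrow> nat \<Rightarrow> nat \<Rightarrow> (4 \<Rightarrow>\<^sub>0 nat)" where
  "expo a b c d = Poly_Mapping.single 1 a + Poly_Mapping.single 2 b
                + Poly_Mapping.single 3 c + Poly_Mapping.single 4 d"

lemma lookup_expo [simp]:
  "Poly_Mapping.lookup (expo a b c d) 1 = a" "Poly_Mapping.lookup (expo a b c d) 2 = b"
  "Poly_Mapping.lookup (expo a b c d) 3 = c" "Poly_Mapping.lookup (expo a b c d) 4 = d"
  by (simp_all add: expo_def lookup_add lookup_single)

lemma expo_eqI:
  assumes "Poly_Mapping.lookup m 1 = a" "Poly_Mapping.lookup m 2 = b"
          "Poly_Mapping.lookup m 3 = c" "Poly_Mapping.lookup m 4 = d"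
  shows "m = expo a b c d"
proof (rule poly_mapping_eqI)
  fix i :: 4
  show "Poly_Mapping.lookup m i = Poly_Mapping.lookup (expo a b c d) i"
    using exhaust_4[of i] assms by auto
qed

lemma expo_inject [simp]:
  "expo a b c d = expo a' b' c' d' \<longleftrightarrow> a = a' \<and> b = b' \<and> c = c' \<and> d = d'"
  by (metis lookup_expo)

definition cubic_exps :: "(4 \<Rightarrow>\<^sub>0 nat) set" where
  "cubic_exps = {expo 3 0 0 0, expo 0 3 0 0, expo 0 0 3 0, expo 0 0 0 3,
     expo 2 1 0 0, expo 2 0 1 0, expo 2 0 0 1, expo 1 2 0 0, expo 0 2 1 0, expo 0 2 0 1,
     expo 1 0 2 0, expo 0 1 2 0, expo 0 0 2 1, expo 1 0 0 2, expo 0 1 0 2, expo 0 0 1 2,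
     expo 1 1 1 0, expo 1 1 0 1, expo 1 0 1 1, expo 0 1 1 1}"

lemma finite_cubic_exps [simp]: "finite cubic_exps"
  by (simp add: cubic_exps_def)

lemma cubic_exps_iff: "m \<in> cubic_exps \<longleftrightarrow> (\<Sum>i\<in>UNIV. Poly_Mapping.lookup m i) = 3"
proof
  assume "m \<in> cubic_exps"
  then show "(\<Sum>i\<in>UNIV. Poly_Mapping.lookup m i) = 3"
    unfolding cubic_exps_def by (auto simp: sum_4)
next
  assume *: "(\<Sum>i\<in>UNIV. Poly_Mapping.lookup m i) = 3"
  obtain a b c d where m: "m = expo a b c d" using expo_eqI by blast
  have s: "a + b + c + d = 3" using * by (simp add: m sum_4)
  then have "a \<in> {0,1,2,3}" "b \<in> {0,1,2,3}" "c \<in> {0,1,2,3}" "d = 3 - a - b - c" by auto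
  then show "m \<in> cubic_exps"
    using s unfolding m cubic_exps_def by (elim insertE emptyE) simp_all
qed

lemma eval4_superset:
  assumes "finite K" "Poly_Mapping.keys F \<subseteq> K"
  shows "eval4 F x = (\<Sum>m\<in>K. Poly_Mapping.lookup F m * (\<Prod>i\<in>UNIV. (x $ i) ^ Poly_Mapping.lookup m i))"
  unfolding eval4_def
  by (rule sum.mono_neutral_left) (use assms in \<open>auto simp: in_keys_iff\<close>)

lemma eval4_0 [simp]: "eval4 0 x = 0"
  by (simp add: eval4_def)

lemma eval4_add: "eval4 (F + G) x = eval4 F x + eval4 G x"
proof -
  let ?K = "Poly_Mapping.keys F \<union> Poly_Mapping.keys G"
  have "Poly_Mapping.keys (F + G) \<subseteq> ?K" by (rule Poly_Mapping.keys_add)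
  then show ?thesis
    by (simp add: eval4_superset[of ?K] lookup_add algebra_simps sum.distrib)
qed

lemma eval4_sum: "eval4 (sum f A) x = (\<Sum>a\<in>A. eval4 (f a) x)"
  by (induction A rule: infinite_finite_induct) (simp_all add: eval4_add)

lemma eval4_single:
  "eval4 (Poly_Mapping.single m c) x = c * (\<Prod>i\<in>UNIV. (x $ i) ^ Poly_Mapping.lookup m i)"
  by (simp add: eval4_superset[of "{m}"] lookup_single)

lemma homogeneous4_cubic: "homogeneous4 3 F \<longleftrightarrow> Poly_Mapping.keys F \<subseteq> cubic_exps"
  unfolding homogeneous4_def subset_iff cubic_exps_iff by blast

lemma eval4_cubic:
  assumes "homogeneous4 3 F"
  shows "eval4 F x = (\<Sum>m\<in>cubic_exps. Poly_Mapping.lookup F m * (\<Prod>i\<in>UNIV. (x $ i) ^ Poly_Mapping.lookup m i))"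
  using assms by (simp add: eval4_superset homogeneous4_cubic)

text \<open>Truncated subtraction in the exponent is harmless: where it truncates, the factor
  \<open>lookup m j\<close> vanishes.\<close>

lemma eval4_partial4_cubic:
  assumes "homogeneous4 3 F"
  shows "eval4 (partial4 j F) x = (\<Sum>m\<in>cubic_exps. of_nat (Poly_Mapping.lookup m j) * Poly_Mapping.lookup F m
     * (\<Prod>i\<in>UNIV. (x $ i) ^ (Poly_Mapping.lookup m i - (if i = j then 1 else 0))))"
proof -
  have "eval4 (partial4 j F) x = (\<Sum>m\<in>Poly_Mapping.keys F. of_nat (Poly_Mapping.lookup m j) * Poly_Mapping.lookup F m
     * (\<Prod>i\<in>UNIV. (x $ i) ^ (Poly_Mapping.lookup m i - (if i = j then 1 else 0))))"
    by (simp add: partial4_def eval4_sum eval4_single lookup_minus lookup_single when_def eq_commute[of j] cong: if_cong)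
  also have "\<dots> = (\<Sum>m\<in>cubic_exps. of_nat (Poly_Mapping.lookup m j) * Poly_Mapping.lookup F m
     * (\<Prod>i\<in>UNIV. (x $ i) ^ (Poly_Mapping.lookup m i - (if i = j then 1 else 0))))"
    by (rule sum.mono_neutral_left) (use assms in \<open>auto simp: in_keys_iff homogeneous4_cubic\<close>)
  finally show ?thesis .
qed

section \<open>Symmetric cubic forms\<close>

definition psum :: "nat \<Rightarrow> 'a::comm_ring_1 ^ 4 \<Rightarrow> 'a" where
  "psum k x = (\<Sum>i\<in>UNIV. (x $ i) ^ k)"

definition cubic :: "'a::comm_ring_1 \<Rightarrow> 'a \<Rightarrow> 'a \<Rightarrow> 'a ^ 4 \<Rightarrow> 'a" where
  "cubic a b c x = a * psum 1 x ^ 3 + b * psum 1 x * psum 2 x + c * psum 3 x"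

definition cubic_partial :: "'a::comm_ring_1 \<Rightarrow> 'a \<Rightarrow> 'a \<Rightarrow> 4 \<Rightarrow> 'a ^ 4 \<Rightarrow> 'a" where
  "cubic_partial a b c i x =
     3 * a * psum 1 x ^ 2 + b * psum 2 x + 2 * b * psum 1 x * x $ i + 3 * c * (x $ i) ^ 2"

text \<open>Adjacent transpositions suffice to bring every exponent vector into decreasing order, so these
  identities reduce all coefficients of a symmetric cubic to three of them.\<close>

lemma symmetric4_swap:
  assumes "symmetric4 F"
  shows "Poly_Mapping.lookup F (expo a b c d) = Poly_Mapping.lookup F (expo b a c d)"
    and "Poly_Mapping.lookup F (expo a b c d) = Poly_Mapping.lookup F (expo a c b d)"
    and "Poly_Mapping.lookup F (expo a b c d) = Poly_Mapping.lookup F (expo a b d c)"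
proof -
  have *: "Poly_Mapping.lookup F (expo (Poly_Mapping.lookup m (\<pi> 1)) (Poly_Mapping.lookup m (\<pi> 2))
      (Poly_Mapping.lookup m (\<pi> 3)) (Poly_Mapping.lookup m (\<pi> 4))) = Poly_Mapping.lookup F m"
    if "bij \<pi>" for m and \<pi> :: "4 \<Rightarrow> 4"
  proof -
    have "Poly_Mapping.map_key \<pi> m = expo (Poly_Mapping.lookup m (\<pi> 1)) (Poly_Mapping.lookup m (\<pi> 2))
      (Poly_Mapping.lookup m (\<pi> 3)) (Poly_Mapping.lookup m (\<pi> 4))"
      using that by (intro expo_eqI) (simp_all add: map_key.rep_eq bij_is_inj)
    then show ?thesis using assms that unfolding symmetric4_def by metis
  qed
  show "Poly_Mapping.lookup F (expo a b c d) = Poly_Mapping.lookup F (expo b a c d)"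
    using *[of "Transposition.transpose 1 2" "expo a b c d"] by (simp add: transpose_def)
  show "Poly_Mapping.lookup F (expo a b c d) = Poly_Mapping.lookup F (expo a c b d)"
    using *[of "Transposition.transpose 2 3" "expo a b c d"] by (simp add: transpose_def)
  show "Poly_Mapping.lookup F (expo a b c d) = Poly_Mapping.lookup F (expo a b d c)"
    using *[of "Transposition.transpose 3 4" "expo a b c d"] by (simp add: transpose_def)
qed

text \<open>The right-hand sides are the coefficients of \<open>x\<^sub>1\<^sup>3\<close>, \<open>x\<^sub>1\<^sup>2 x\<^sub>2\<close> and \<open>x\<^sub>1 x\<^sub>2 x\<^sub>3\<close> in
  \<open>a p\<^sub>1\<^sup>3 + b p\<^sub>1 p\<^sub>2 + c p\<^sub>3\<close>.\<close>

lemma eval4_symmetric_cubic: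
  assumes "homogeneous4 3 F" "symmetric4 F"
    and "Poly_Mapping.lookup F (expo 3 0 0 0) = a + b + c"
    and "Poly_Mapping.lookup F (expo 2 1 0 0) = 3 * a + b"
    and "Poly_Mapping.lookup F (expo 1 1 1 0) = 6 * a"
  shows "eval4 F x = cubic a b c x"
    and "eval4 (partial4 i F) x = cubic_partial a b c i x"
proof -
  note sw = symmetric4_swap[OF assms(2)]
  have c3: "Poly_Mapping.lookup F (expo 0 3 0 0) = a + b + c"
     "Poly_Mapping.lookup F (expo 0 0 3 0) = a + b + c"
     "Poly_Mapping.lookup F (expo 0 0 0 3) = a + b + c"
    using assms(3) sw by metis+
  have c2: "Poly_Mapping.lookup F (expo 2 0 1 0) = 3 * a + b"
     "Poly_Mapping.lookup F (expo 2 0 0 1) = 3 * a + b"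
     "Poly_Mapping.lookup F (expo 1 2 0 0) = 3 * a + b"
     "Poly_Mapping.lookup F (expo 0 2 1 0) = 3 * a + b"
     "Poly_Mapping.lookup F (expo 0 2 0 1) = 3 * a + b"
     "Poly_Mapping.lookup F (expo 1 0 2 0) = 3 * a + b"
     "Poly_Mapping.lookup F (expo 0 1 2 0) = 3 * a + b"
     "Poly_Mapping.lookup F (expo 0 0 2 1) = 3 * a + b"
     "Poly_Mapping.lookup F (expo 1 0 0 2) = 3 * a + b"
     "Poly_Mapping.lookup F (expo 0 1 0 2) = 3 * a + b"
     "Poly_Mapping.lookup F (expo 0 0 1 2) = 3 * a + b"
    using assms(4) sw by metis+
  have c1: "Poly_Mapping.lookup F (expo 1 1 0 1) = 6 * a"
     "Poly_Mapping.lookup F (expo 1 0 1 1) = 6 * a"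
     "Poly_Mapping.lookup F (expo 0 1 1 1) = 6 * a"
    using assms(5) sw by metis+
  note cs = assms(3-5)[unfolded One_nat_def] c3 c2[unfolded One_nat_def] c1[unfolded One_nat_def]
  show "eval4 F x = cubic a b c x"
    unfolding eval4_cubic[OF assms(1)]
    by (simp add: cubic_exps_def cs cubic_def psum_def sum_4 prod_4 algebra_simps power2_eq_square power3_eq_cube)
  have "\<forall>i. eval4 (partial4 i F) x = cubic_partial a b c i x"
    unfolding eval4_partial4_cubic[OF assms(1)] forall_4
    by (simp add: cubic_exps_def cs cubic_partial_def psum_def sum_4 prod_4 algebra_simps power2_eq_square power3_eq_cube)
  then show "eval4 (partial4 i F) x = cubic_partial a b c i x" by blast
qed

lemma lookup_complexify4 [simp]:
  "Poly_Mapping.lookup (complexify4 F) m = complex_of_real (Poly_Mapping.lookup F m)"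
  by (simp add: complexify4_def map.rep_eq when_def)

lemma complexify4_symmetric_cubic:
  assumes "homogeneous4 3 F" "symmetric4 F"
    and "Poly_Mapping.lookup F (expo 3 0 0 0) = a + b + c"
    and "Poly_Mapping.lookup F (expo 2 1 0 0) = 3 * a + b"
    and "Poly_Mapping.lookup F (expo 1 1 1 0) = 6 * a"
  shows "eval4 (complexify4 F) z = cubic (of_real a) (of_real b) (of_real c) z"
    and "eval4 (partial4 i (complexify4 F)) z = cubic_partial (of_real a) (of_real b) (of_real c) i z"
proof -
  have k: "Poly_Mapping.keys (complexify4 F) = Poly_Mapping.keys F"
    by (auto simp: in_keys_iff)
  have "homogeneous4 3 (complexify4 F)"
    using assms(1) unfolding homogeneous4_def k .
  moreover have "symmetric4 (complexify4 F)"
    using assms(2) unfolding symmetric4_def by simp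
  ultimately show "eval4 (complexify4 F) z = cubic (of_real a) (of_real b) (of_real c) z"
    and "eval4 (partial4 i (complexify4 F)) z = cubic_partial (of_real a) (of_real b) (of_real c) i z"
    using assms(3-5) by (auto intro!: eval4_symmetric_cubic)
qed

text \<open>The passage from the coefficients of monomials to those of power sums is triangular, with
  diagonal entries \<open>6, 1, 1\<close>.\<close>

lemma symmetric_cubic_cases:
  assumes "homogeneous4 3 F" "symmetric4 F"
  obtains a b c where
    "\<And>z. eval4 (complexify4 F) z = cubic (of_real a) (of_real b) (of_real c) z"
    "\<And>i z. eval4 (partial4 i (complexify4 F)) z = cubic_partial (of_real a) (of_real b) (of_real c) i z"
proof -
  define A B C where "A = Poly_Mapping.lookup F (expo 3 0 0 0)"
    and "B = Poly_Mapping.lookup F (expo 2 1 0 0)" and "C = Poly_Mapping.lookup F (expo 1 1 1 0)"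
  have e: "Poly_Mapping.lookup F (expo 3 0 0 0) = C / 6 + (B - C / 2) + (A - B + C / 3)"
    "Poly_Mapping.lookup F (expo 2 1 0 0) = 3 * (C / 6) + (B - C / 2)"
    "Poly_Mapping.lookup F (expo 1 1 1 0) = 6 * (C / 6)"
    by (simp_all add: A_def B_def C_def)
  show thesis
    by (rule that[OF complexify4_symmetric_cubic[OF assms e]])
qed

text \<open>The three orbits of cubic exponent vectors under permutations, those of \<open>(3,0,0,0)\<close>,
  \<open>(2,1,0,0)\<close> and \<open>(1,1,1,0)\<close>, are told apart by the sum of squares of the exponents, which
  is 9, 5 and 3.  As this quantity is visibly invariant, so are the coefficients.\<close>

definition cubic_poly :: "'a::comm_ring_1 \<Rightarrow> 'a \<Rightarrow> 'a \<Rightarrow> 'a poly4" where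
  "cubic_poly a b c = (\<Sum>m\<in>cubic_exps. Poly_Mapping.single m
     (let s = \<Sum>i\<in>UNIV. (Poly_Mapping.lookup m i) ^ 2
      in if s = 9 then a + b + c else if s = 5 then 3 * a + b else 6 * a))"

lemma lookup_cubic_poly:
  "Poly_Mapping.lookup (cubic_poly a b c) m = (if m \<in> cubic_exps then
     (let s = \<Sum>i\<in>UNIV. (Poly_Mapping.lookup m i) ^ 2
      in if s = 9 then a + b + c else if s = 5 then 3 * a + b else 6 * a) else 0)"
  unfolding cubic_poly_def lookup_sum lookup_single when_def
  by (subst sum.delta) auto

lemma homogeneous4_cubic_poly: "homogeneous4 3 (cubic_poly a b c)"
  by (auto simp: homogeneous4_cubic in_keys_iff lookup_cubic_poly split: if_splits)

lemma symmetric4_cubic_poly: "symmetric4 (cubic_poly a b c)"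
  unfolding symmetric4_def
proof (intro allI impI)
  fix \<pi> :: "4 \<Rightarrow> 4" and m :: "4 \<Rightarrow>\<^sub>0 nat"
  assume \<pi>: "bij \<pi>"
  have *: "(\<Sum>i\<in>UNIV. g (Poly_Mapping.lookup (Poly_Mapping.map_key \<pi> m) i))
      = (\<Sum>i\<in>UNIV. g (Poly_Mapping.lookup m i))" for g :: "nat \<Rightarrow> nat"
    using sum.reindex_bij_betw[OF \<pi>, of "\<lambda>i. g (Poly_Mapping.lookup m i)"]
    by (simp add: map_key.rep_eq bij_is_inj[OF \<pi>])
  show "Poly_Mapping.lookup (cubic_poly a b c) (Poly_Mapping.map_key \<pi> m)
      = Poly_Mapping.lookup (cubic_poly a b c) m"
    unfolding lookup_cubic_poly cubic_exps_iff *[of "\<lambda>n. n"] *[of "\<lambda>n. n ^ 2"] ..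
qed

lemma complexify4_cubic_poly:
  shows "eval4 (complexify4 (cubic_poly a b c)) z = cubic (of_real a) (of_real b) (of_real c) z"
    and "eval4 (partial4 i (complexify4 (cubic_poly a b c))) z
      = cubic_partial (of_real a) (of_real b) (of_real c) i z"
  by (rule complexify4_symmetric_cubic[OF homogeneous4_cubic_poly symmetric4_cubic_poly];
      simp add: lookup_cubic_poly cubic_exps_iff sum_4)+

section \<open>Real lines as real planes\<close>

definition cvec :: "real ^ 4 \<Rightarrow> complex ^ 4" where "cvec x = (\<chi> i. complex_of_real (x $ i))"
definition Re_vec :: "complex ^ 4 \<Rightarrow> real ^ 4" where "Re_vec z = (\<chi> i. Re (z $ i))"
definition Im_vec :: "complex ^ 4 \<Rightarrow> real ^ 4" where "Im_vec z = (\<chi> i. Im (z $ i))"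

definition complexification :: "(real ^ 4) set \<Rightarrow> (complex ^ 4) set" where
  "complexification U = {z. Re_vec z \<in> U \<and> Im_vec z \<in> U}"

lemma Re_vec_simps [simp]:
  "Re_vec 0 = 0" "Re_vec (z + w) = Re_vec z + Re_vec w"
  "Re_vec (c *s z) = Re c *\<^sub>R Re_vec z - Im c *\<^sub>R Im_vec z" "Re_vec (cvec x) = x"
  by (simp_all add: Re_vec_def Im_vec_def cvec_def vec_eq_iff)

lemma Im_vec_simps [simp]:
  "Im_vec 0 = 0" "Im_vec (z + w) = Im_vec z + Im_vec w"
  "Im_vec (c *s z) = Re c *\<^sub>R Im_vec z + Im c *\<^sub>R Re_vec z" "Im_vec (cvec x) = 0"
  by (simp_all add: Re_vec_def Im_vec_def cvec_def vec_eq_iff)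

lemma cvec_decompose: "z = cvec (Re_vec z) + \<i> *s cvec (Im_vec z)"
  by (simp add: Re_vec_def Im_vec_def cvec_def vec_eq_iff complex_eq_iff)

lemma cvec_simps: "cvec 0 = 0" "cvec (x + y) = cvec x + cvec y" "cvec (r *\<^sub>R x) = of_real r *s cvec x"
  by (simp_all add: cvec_def vec_eq_iff)

lemma cvec_in_complexification [simp]: "subspace U \<Longrightarrow> cvec x \<in> complexification U \<longleftrightarrow> x \<in> U"
  by (simp add: complexification_def subspace_0)

lemma vec_subspace_complexification: "subspace U \<Longrightarrow> vec.subspace (complexification U)"
  unfolding vec.subspace_def
  by (auto simp: complexification_def subspace_0 intro!: subspace_add subspace_scale subspace_diff)

lemma Re_vec_sum: "Re_vec (sum f A) = (\<Sum>a\<in>A. Re_vec (f a))"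
  by (induction A rule: infinite_finite_induct) simp_all

lemma Im_vec_sum: "Im_vec (sum f A) = (\<Sum>a\<in>A. Im_vec (f a))"
  by (induction A rule: infinite_finite_induct) simp_all

text \<open>A real basis remains a basis over \<open>\<complex>\<close>: a complex linear relation between real vectors splits
  into two real ones, its real and its imaginary part.\<close>

lemma dim_complexification:
  assumes U: "subspace U"
  shows "vec.dim (complexification U) = dim U"
proof -
  obtain B where B: "B \<subseteq> U" "independent B" "U \<subseteq> span B" "card B = dim U"
    using basis_exists by blast
  have fin: "finite B" using B(2) by (rule independent_imp_finite)
  have inj: "inj_on cvec B" by (metis Re_vec_simps(4) inj_on_inverseI)
  have sp: "cvec x \<in> vec.span (cvec ` B)" if "x \<in> span B" for x
    using that
  proof (induction rule: span_induct)
    case base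
    show ?case
      by (auto simp: subspace_def cvec_simps vec.span_zero intro: vec.span_add vec.span_scale)
  next
    case (step x)
    then show ?case by (simp add: vec.span_base)
  qed
  show ?thesis
  proof (rule vec.dim_unique)
    show "cvec ` B \<subseteq> complexification U" using B(1) U by auto
    show "complexification U \<subseteq> vec.span (cvec ` B)"
    proof
      fix z assume "z \<in> complexification U"
      then have "cvec (Re_vec z) \<in> vec.span (cvec ` B)" "cvec (Im_vec z) \<in> vec.span (cvec ` B)"
        using B(3) sp by (auto simp: complexification_def)
      then have "cvec (Re_vec z) + \<i> *s cvec (Im_vec z) \<in> vec.span (cvec ` B)"
        by (intro vec.span_add vec.span_scale)
      then show "z \<in> vec.span (cvec ` B)" using cvec_decompose[of z] by simp
    qed
    show "vec.independent (cvec ` B)"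
    proof (rule vec.independent_if_scalars_zero)
      show "finite (cvec ` B)" using fin by simp
    next
      fix f x assume s: "(\<Sum>x\<in>cvec ` B. f x *s x) = 0" and x: "x \<in> cvec ` B"
      from s have s': "(\<Sum>b\<in>B. f (cvec b) *s cvec b) = 0" by (simp add: sum.reindex[OF inj])
      have "(\<Sum>b\<in>B. Re (f (cvec b)) *\<^sub>R b) = 0"
        using arg_cong[OF s', of Re_vec] by (simp add: Re_vec_sum)
      moreover have "(\<Sum>b\<in>B. Im (f (cvec b)) *\<^sub>R b) = 0"
        using arg_cong[OF s', of Im_vec] by (simp add: Im_vec_sum)
      ultimately have "\<forall>b\<in>B. Re (f (cvec b)) = 0 \<and> Im (f (cvec b)) = 0"
        using independentD[OF B(2) fin order_refl, of "\<lambda>b. Re (f (cvec b))"]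
          independentD[OF B(2) fin order_refl, of "\<lambda>b. Im (f (cvec b))"] by blast
      then show "f x = 0" using x by (auto simp: complex_eq_iff)
    qed
    show "card (cvec ` B) = dim U" using B(4) inj by (simp add: card_image)
  qed
qed

lemma real_linear_zeros_eq: "real_linear_zeros A = complexification (orthogonal_comp A)"
  by (auto simp: real_linear_zeros_def complexification_def orthogonal_comp_def orthogonal_def
      inner_vec_def complex_eq_iff Re_vec_def Im_vec_def)

lemma complexification_inj:
  assumes "subspace U" "subspace V" "complexification U = complexification V"
  shows "U = V"
  using assms cvec_in_complexification by blast

lemma span_in_CP3: "z \<noteq> 0 \<Longrightarrow> vec.span {z} \<in> CP3"
  by (simp add: CP3_def vec.dim_eq_card_independent)

lemma mem_projectivization:
  assumes "vec.subspace W" "z \<noteq> 0"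
  shows "vec.span {z} \<in> projectivization W \<longleftrightarrow> z \<in> W"
  using assms span_in_CP3[of z]
  by (auto simp: projectivization_def vec.span_base intro: vec.span_minimal[THEN subsetD])

text \<open>A linear subspace is the union of the points of its projectivization, except that the zero
  space has no points.\<close>

lemma projectivization_inj:
  assumes "vec.subspace W" "vec.subspace W'" "projectivization W = projectivization W'"
  shows "W = W'"
proof -
  have "z \<in> W \<longleftrightarrow> z \<in> W'" for z
    by (cases "z = 0") (use assms mem_projectivization vec.subspace_0 in blast)+
  then show ?thesis by blast
qed

lemma cubic_scale: "cubic a b c (k *s x) = k ^ 3 * cubic a b c x"
  by (simp add: cubic_def psum_def sum_4 algebra_simps power2_eq_square power3_eq_cube)

lemma cubic_0: "cubic a b c 0 = 0"
  by (simp add: cubic_def psum_def)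

lemma span_in_surface:
  assumes "\<And>z. eval4 (complexify4 F) z = cubic a b c z" "z \<noteq> 0"
  shows "vec.span {z} \<in> surface F \<longleftrightarrow> cubic a b c z = 0"
  using assms span_in_CP3[of z]
  by (auto simp: surface_def vec.span_singleton cubic_scale vec.span_base)

text \<open>The real model of the set of real lines on the surface \<open>f = 0\<close>.\<close>

definition real_planes :: "(real ^ 4 \<Rightarrow> real) \<Rightarrow> (real ^ 4) set set" where
  "real_planes f = {U. subspace U \<and> dim U = 2 \<and> (\<forall>x\<in>U. f x = 0)}"

lemma cubic_cvec:
  "cubic (of_real a) (of_real b) (of_real c) (cvec x) = of_real (cubic a b c x)"
  by (simp add: cubic_def psum_def cvec_def)

text \<open>The derivative of \<open>cubic a b c\<close> at \<open>x\<close> in direction \<open>y\<close>.\<close>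

definition cubic_polar :: "'a::comm_ring_1 \<Rightarrow> 'a \<Rightarrow> 'a \<Rightarrow> 'a ^ 4 \<Rightarrow> 'a ^ 4 \<Rightarrow> 'a" where
  "cubic_polar a b c x y = (\<Sum>i\<in>UNIV. cubic_partial a b c i x * y $ i)"

text \<open>The Taylor expansion along a line.  It holds over every commutative ring, so the same
  coefficients govern the real and the complex points of a line spanned by real vectors.\<close>

lemma cubic_on_line:
  "cubic a b c (x + e *s y) =
     cubic a b c x + e * cubic_polar a b c x y + e ^ 2 * cubic_polar a b c y x + e ^ 3 * cubic a b c y"
proof -
  define m where "m = (\<lambda>j k. \<Sum>i\<in>UNIV. (x $ i) ^ j * (y $ i) ^ k)"
  have pol: "cubic_polar a b c x y = 3 * a * (psum 1 x)\<^sup>2 * psum 1 y + b * psum 2 x * psum 1 y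
      + 2 * b * psum 1 x * m 1 1 + 3 * c * m 2 1"
    "cubic_polar a b c y x = 3 * a * (psum 1 y)\<^sup>2 * psum 1 x + b * psum 2 y * psum 1 x
      + 2 * b * psum 1 y * m 1 1 + 3 * c * m 1 2"
    unfolding cubic_polar_def cubic_partial_def m_def
    by (simp_all add: psum_def sum_4 distrib_left distrib_right mult_ac)
  have p1: "psum 1 (x + e *s y) = psum 1 x + e * psum 1 y"
    by (simp add: psum_def sum_4 distrib_left ac_simps)
  have p2: "psum 2 (x + e *s y) = psum 2 x + 2 * e * m 1 1 + e ^ 2 * psum 2 y"
    by (simp add: psum_def m_def sum_4 algebra_simps power2_eq_square)
  have p3: "psum 3 (x + e *s y) = psum 3 x + 3 * e * m 2 1 + 3 * e ^ 2 * m 1 2 + e ^ 3 * psum 3 y"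
    by (simp add: psum_def m_def sum_4 algebra_simps power2_eq_square power3_eq_cube)
  show ?thesis
    unfolding cubic_def pol p1 p2 p3 by (simp add: algebra_simps power2_eq_square power3_eq_cube)
qed

lemma cubic_polar_cvec:
  "cubic_polar (of_real a) (of_real b) (of_real c) (cvec x) (cvec y) = of_real (cubic_polar a b c x y)"
  by (simp add: cubic_polar_def cubic_partial_def psum_def cvec_def)

text \<open>By the Taylor expansion at \<open>x\<close> in direction \<open>y\<close>, the values at \<open>x\<close>, \<open>y\<close>, \<open>x + y\<close> and
  \<open>x - y\<close> determine all four coefficients, and hence the value at \<open>x + \<i> y\<close>.\<close>

lemma cubic_vanishes_complexification:
  assumes U: "subspace U"
  shows "(\<forall>z\<in>complexification U. cubic (of_real a) (of_real b) (of_real c) z = 0)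
     \<longleftrightarrow> (\<forall>x\<in>U. cubic a b c x = 0)"
proof
  assume "\<forall>z\<in>complexification U. cubic (of_real a) (of_real b) (of_real c) z = 0"
  then show "\<forall>x\<in>U. cubic a b c x = 0"
    using cvec_in_complexification[OF U] cubic_cvec by (metis of_real_eq_0_iff)
next
  assume *: "\<forall>x\<in>U. cubic a b c x = 0"
  show "\<forall>z\<in>complexification U. cubic (of_real a) (of_real b) (of_real c) z = 0"
  proof
    fix z assume "z \<in> complexification U"
    then have "Re_vec z \<in> U" "Im_vec z \<in> U" by (auto simp: complexification_def)
    define x y where "x = Re_vec z" and "y = Im_vec z"
    have xy: "x \<in> U" "y \<in> U" "x + 1 *s y \<in> U" "x + (-1) *s y \<in> U"
      using \<open>Re_vec z \<in> U\<close> \<open>Im_vec z \<in> U\<close> U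
      by (simp_all add: x_def y_def subspace_add subspace_diff scalar_mult_eq_scaleR)
    then have "cubic a b c x = 0" "cubic a b c y = 0"
      "cubic_polar a b c x y + cubic_polar a b c y x = 0"
      "- cubic_polar a b c x y + cubic_polar a b c y x = 0"
      using * cubic_on_line[of a b c x 1 y] cubic_on_line[of a b c x "-1" y] by simp_all
    then have "cubic a b c x = 0" "cubic a b c y = 0" "cubic_polar a b c x y = 0" "cubic_polar a b c y x = 0"
      by linarith+
    then have "cubic (of_real a) (of_real b) (of_real c) (cvec x + \<i> *s cvec y) = 0"
      unfolding cubic_on_line cubic_polar_cvec cubic_cvec by simp
    then show "cubic (of_real a) (of_real b) (of_real c) z = 0"
      using cvec_decompose[of z] by (simp add: x_def y_def)
  qed
qed

text \<open>Complexification is the bijection.  It hits every real line because the zero set of real linear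
  forms is the complexification of the orthogonal complement of their coefficient vectors.\<close>

lemma card_real_lines:
  assumes F: "\<And>z. eval4 (complexify4 F) z = cubic (of_real a) (of_real b) (of_real c) z"
  shows "card (real_lines F) = card (real_planes (cubic a b c))"
proof -
  let ?\<Phi> = "\<lambda>U. projectivization (complexification U)"
  let ?f = "cubic (complex_of_real a) (complex_of_real b) (complex_of_real c)"
  have sub: "projectivization W \<subseteq> surface F \<longleftrightarrow> (\<forall>z\<in>W. ?f z = 0)" if W: "vec.subspace W" for W
  proof
    assume *: "projectivization W \<subseteq> surface F"
    show "\<forall>z\<in>W. ?f z = 0"
    proof
      fix z assume "z \<in> W"
      show "?f z = 0"
        using * mem_projectivization[OF W, of z] span_in_surface[OF F, of z] \<open>z \<in> W\<close>
        by (cases "z = 0") (auto simp: cubic_0)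
    qed
  next
    assume "\<forall>z\<in>W. ?f z = 0"
    then show "projectivization W \<subseteq> surface F"
      by (auto simp: projectivization_def surface_def F)
  qed
  have "real_lines F = ?\<Phi> ` real_planes (cubic a b c)"
  proof (intro equalityI subsetI)
    fix L assume "L \<in> real_lines F"
    then obtain W A where W: "vec.subspace W" "vec.dim W = 2" "L = projectivization W"
      and A: "L = projectivization (real_linear_zeros A)" and L: "L \<subseteq> surface F"
      by (auto simp: real_lines_def is_real_line_def is_line_def)
    define U where "U = orthogonal_comp A"
    have U: "subspace U" by (simp add: U_def subspace_orthogonal_comp)
    have WU: "W = complexification U"
      using W A U by (simp add: U_def real_linear_zeros_eq projectivization_inj vec_subspace_complexification)
    have "U \<in> real_planes (cubic a b c)"
      using U W L sub[OF W(1)] cubic_vanishes_complexification[OF U] dim_complexification[OF U]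
      by (simp add: real_planes_def WU)
    then show "L \<in> ?\<Phi> ` real_planes (cubic a b c)" using W WU by blast
  next
    fix L assume "L \<in> ?\<Phi> ` real_planes (cubic a b c)"
    then obtain U where U: "subspace U" "dim U = 2" "\<forall>x\<in>U. cubic a b c x = 0" "L = ?\<Phi> U"
      by (auto simp: real_planes_def)
    have "real_linear_zeros (orthogonal_comp U) = complexification U"
      using U(1) by (simp add: real_linear_zeros_eq orthogonal_comp_self)
    then have "is_real_line L"
      unfolding is_real_line_def is_line_def
      using U(2,4) dim_complexification[OF U(1)] vec_subspace_complexification[OF U(1)] by metis
    then show "L \<in> real_lines F"
      using U(3,4) sub[OF vec_subspace_complexification[OF U(1)]]
        cubic_vanishes_complexification[OF U(1)] by (simp add: real_lines_def)
  qed
  moreover have "inj_on ?\<Phi> (real_planes (cubic a b c))"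
  proof (rule inj_onI)
    fix U V assume *: "U \<in> real_planes (cubic a b c)" "V \<in> real_planes (cubic a b c)" "?\<Phi> U = ?\<Phi> V"
    then have UV: "subspace U" "subspace V" by (auto simp: real_planes_def)
    then have "complexification U = complexification V"
      using *(3) by (intro projectivization_inj vec_subspace_complexification)
    then show "U = V" using UV by (intro complexification_inj)
  qed
  ultimately show ?thesis by (simp add: card_image)
qed

section \<open>Planes in real four-space\<close>

lemma spanning_pair:
  fixes u v :: "real ^ 4"
  assumes "u $ i = 1" "v $ i = 0" "v \<noteq> 0"
  shows "independent {u, v}" "card {u, v} = 2"
proof -
  have "u \<noteq> v" using assms by auto
  then show "card {u, v} = 2" by simp
  have "u \<notin> span {v}"
    using assms by (auto simp: span_singleton)
  then show "independent {u, v}"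
    using assms(3) by (simp add: independent_insert)
qed

lemma in_span_pair: "y \<in> span {u, v} \<longleftrightarrow> (\<exists>s r. y = s *\<^sub>R u + r *\<^sub>R v)"
proof
  assume "y \<in> span {u, v}"
  then obtain s r where "y - s *\<^sub>R u = r *\<^sub>R v"
    by (auto simp: span_breakdown_eq[of y u] span_singleton)
  then have "y = s *\<^sub>R u + r *\<^sub>R v" by (simp add: algebra_simps)
  then show "\<exists>s r. y = s *\<^sub>R u + r *\<^sub>R v" by blast
qed (auto intro!: span_add span_scale intro: span_base)

lemma dim_eq_2I:
  fixes u v :: "real ^ 4"
  assumes "u \<in> V" "v \<in> V" "u $ i = 1" "v $ i = 0" "v \<noteq> 0"
    and "\<And>y. y \<in> V \<Longrightarrow> \<exists>s r. y = s *\<^sub>R u + r *\<^sub>R v"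
  shows "dim V = 2"
  by (rule dim_unique[of "{u, v}"]) (use assms spanning_pair[of u i v] in \<open>auto simp: in_span_pair\<close>)

text \<open>If the coordinate \<open>i\<close> does not vanish on a plane, the plane has a basis consisting of a point of
  the affine chart \<open>y\<^sub>i = 1\<close> and a direction at infinity.\<close>

lemma plane_basis:
  fixes U :: "(real ^ 4) set"
  assumes U: "subspace U" "dim U = 2" and w: "w \<in> U" "w $ i \<noteq> 0"
  obtains u v where "u \<in> U" "v \<in> U" "u $ i = 1" "v $ i = 0" "v \<noteq> 0" "U = span {u, v}"
proof -
  define u where "u = (1 / w $ i) *\<^sub>R w"
  have u: "u \<in> U" "u $ i = 1" using U w by (auto simp: u_def subspace_scale)
  have "\<not> U \<subseteq> span {u}"
  proof
    assume "U \<subseteq> span {u}"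
    then have "dim U \<le> card {u}" by (intro dim_le_card) auto
    then show False using U(2) by simp
  qed
  then obtain x where x: "x \<in> U" "x \<notin> span {u}" by blast
  define v where "v = x - (x $ i) *\<^sub>R u"
  have v: "v \<in> U" "v $ i = 0" "v \<noteq> 0"
    using x U(1) u by (auto simp: v_def subspace_diff subspace_scale span_singleton)
  have "U \<subseteq> span {u, v}"
    using card_eq_dim[of "{u, v}" U] spanning_pair[OF u(2) v(2,3)] u v U(2) by simp
  moreover have "span {u, v} \<subseteq> U" using u v U(1) by (intro span_minimal) auto
  ultimately show thesis using that[OF u(1) v(1) u(2) v(2,3)] by blast
qed

lemma card_real_planes_linear:
  fixes T :: "real ^ 4 \<Rightarrow> real ^ 4"
  assumes T: "linear T" "inj T" and r: "r \<noteq> 0" and f: "\<And>x. f x = r * g (T x)"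
  shows "card (real_planes f) = card (real_planes g)"
proof -
  have surj: "surj T" using T by (rule linear_inj_imp_surj)
  have dim: "dim (T ` U) = dim U" for U
    using T by (intro dim_image_eq) (auto intro: inj_on_subset)
  have "image T ` real_planes f = real_planes g"
  proof (intro equalityI subsetI)
    fix V assume "V \<in> image T ` real_planes f"
    then show "V \<in> real_planes g"
      using r f dim by (auto simp: real_planes_def linear_subspace_image[OF T(1)])
  next
    fix V assume V: "V \<in> real_planes g"
    define U where "U = T -` V"
    have im: "T ` U = V" unfolding U_def using surj by (rule surj_image_vimage_eq)
    have sub: "subspace U" using V T(1) by (simp add: U_def real_planes_def linear_subspace_vimage)
    moreover have "dim U = 2" using dim[of U] V im by (simp add: real_planes_def)
    moreover have "\<forall>x\<in>U. f x = 0" using V f by (simp add: U_def real_planes_def)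
    ultimately show "V \<in> image T ` real_planes f" using im by (auto simp: real_planes_def)
  qed
  moreover have "inj_on (image T) (real_planes f)" using T(2) by (simp add: inj_image_eq_iff inj_on_def)
  ultimately show ?thesis using card_image by metis
qed

section \<open>The lines of the normal form\<close>

text \<open>The normal form, with \<open>y $ 4\<close> in the role of \<open>t\<close>.\<close>

definition normal_cubic :: "real \<Rightarrow> real ^ 4 \<Rightarrow> real" where
  "normal_cubic m y = y $ 4 * ((y $ 1)\<^sup>2 + (y $ 2)\<^sup>2 + (y $ 3)\<^sup>2) - m * (y $ 4) ^ 3 + 2 * y $ 1 * y $ 2 * y $ 3"

text \<open>The form \<open>normal_cubic m\<close> is invariant under cyclic permutations of the first three coordinates.
  In a frame \<open>(a, b, c)\<close>, the index \<open>a\<close> singles out the line \<open>t = y\<^sub>a = 0\<close>.  Only cyclic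
  permutations are admitted, so that \<open>a\<close> determines \<open>b\<close> and \<open>c\<close>.\<close>

definition frame :: "4 \<Rightarrow> 4 \<Rightarrow> 4 \<Rightarrow> bool" where
  "frame a b c \<longleftrightarrow> (a, b, c) \<in> {(1, 2, 3), (2, 3, 1), (3, 1, 2)}"

lemma frame_distinct:
  assumes "frame a b c"
  shows "a \<noteq> b" "a \<noteq> c" "b \<noteq> c" "a \<noteq> 4" "b \<noteq> 4" "c \<noteq> 4" "i = a \<or> i = b \<or> i = c \<or> i = 4"
  using assms exhaust_4[of i] by (auto simp: frame_def)

lemma normal_cubic_frame:
  assumes "frame a b c"
  shows "normal_cubic m y = y $ 4 * ((y $ a)\<^sup>2 + (y $ b)\<^sup>2 + (y $ c)\<^sup>2) - m * (y $ 4) ^ 3 + 2 * y $ a * y $ b * y $ c"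
  using assms by (auto simp: frame_def normal_cubic_def algebra_simps)

definition base_line :: "4 \<Rightarrow> (real ^ 4) set" where
  "base_line a = {y. y $ 4 = 0 \<and> y $ a = 0}"

text \<open>A line that meets \<open>t = y\<^sub>a = 0\<close> in a point with \<open>y\<^sub>b \<noteq> 0\<close>, and does not lie in \<open>t = 0\<close>, is
  a graph over the coordinates \<open>t\<close> and \<open>y\<^sub>b\<close>.  Its parameters are therefore unique.\<close>

definition graph_line :: "4 \<Rightarrow> 4 \<Rightarrow> 4 \<Rightarrow> real \<Rightarrow> real \<Rightarrow> real \<Rightarrow> (real ^ 4) set" where
  "graph_line a b c \<alpha> \<rho> \<kappa> = {y. y $ a = \<alpha> * y $ 4 \<and> y $ c = \<rho> * y $ b + \<kappa> * y $ 4}"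

text \<open>The three equations are the vanishing of the coefficients of \<open>y\<^sub>b\<^sup>2\<close>, \<open>t y\<^sub>b\<close> and \<open>t\<^sup>2\<close> in
  the restriction of the normal form to a graph line, divided by \<open>t\<close>;
  the second of these coefficients is \<open>2 \<kappa> (\<rho> + \<alpha>)\<close>.\<close>

definition line_params :: "real \<Rightarrow> (real \<times> real \<times> real) set" where
  "line_params m = {(\<alpha>, \<rho>, \<kappa>). 1 + \<rho>\<^sup>2 + 2 * \<alpha> * \<rho> = 0 \<and> \<kappa> * (\<rho> + \<alpha>) = 0 \<and> \<alpha>\<^sup>2 + \<kappa>\<^sup>2 = m}"

lemma subspace_base_line: "subspace (base_line a)"
  by (auto simp: base_line_def subspace_def)

lemma subspace_graph_line: "subspace (graph_line a b c \<alpha> \<rho> \<kappa>)"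
  by (auto simp: graph_line_def subspace_def algebra_simps)

lemma vec_eq_frame:
  assumes "frame a b c"
  shows "x = y \<longleftrightarrow> x $ a = y $ a \<and> x $ b = y $ b \<and> x $ c = y $ c \<and> x $ 4 = y $ 4"
  unfolding vec_eq_iff using frame_distinct(7)[OF assms] by metis

lemma dim_base_line:
  assumes f: "frame a b c"
  shows "dim (base_line a) = 2"
proof (rule dim_eq_2I[of "axis b 1" _ "axis c 1" b])
  fix y assume "y \<in> base_line a"
  then show "\<exists>s r. y = s *\<^sub>R axis b 1 + r *\<^sub>R axis c 1"
    using frame_distinct[OF f]
    by (intro exI[of _ "y $ b"] exI[of _ "y $ c"]) (auto simp: vec_eq_frame[OF f] base_line_def axis_def)
qed (use frame_distinct[OF f] in \<open>auto simp: base_line_def axis_def vec_eq_iff\<close>)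

text \<open>Together with \<open>graph_dir\<close> below, this is the standard basis of a graph line: the points with
  \<open>(t, y\<^sub>b) = (1, 0)\<close> and \<open>(t, y\<^sub>b) = (0, 1)\<close>.\<close>

definition graph_point :: "4 \<Rightarrow> 4 \<Rightarrow> real \<Rightarrow> real \<Rightarrow> real ^ 4" where
  "graph_point a c \<alpha> \<kappa> = (\<chi> i. if i = 4 then 1 else if i = a then \<alpha> else if i = c then \<kappa> else 0)"

definition graph_dir :: "4 \<Rightarrow> 4 \<Rightarrow> real \<Rightarrow> real ^ 4" where
  "graph_dir b c \<rho> = (\<chi> i. if i = b then 1 else if i = c then \<rho> else 0)"

lemma graph_point_dir_in:
  assumes f: "frame a b c"
  shows "graph_point a c \<alpha> \<kappa> \<in> graph_line a b c \<alpha> \<rho> \<kappa>" "graph_dir b c \<rho> \<in> graph_line a b c \<alpha> \<rho> \<kappa>"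
  using frame_distinct[OF f] by (auto simp: graph_line_def graph_point_def graph_dir_def)

lemma dim_graph_line:
  assumes f: "frame a b c"
  shows "dim (graph_line a b c \<alpha> \<rho> \<kappa>) = 2"
proof (rule dim_eq_2I[of "graph_point a c \<alpha> \<kappa>" _ "graph_dir b c \<rho>" 4])
  fix y assume "y \<in> graph_line a b c \<alpha> \<rho> \<kappa>"
  then show "\<exists>s r. y = s *\<^sub>R graph_point a c \<alpha> \<kappa> + r *\<^sub>R graph_dir b c \<rho>"
    using frame_distinct[OF f]
    by (intro exI[of _ "y $ 4"] exI[of _ "y $ b"])
       (auto simp: vec_eq_frame[OF f] graph_line_def graph_point_def graph_dir_def)
qed (use frame_distinct[OF f] graph_point_dir_in[OF f] in \<open>auto simp: graph_point_def graph_dir_def vec_eq_iff\<close>)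

lemma graph_line_vanishes:
  assumes f: "frame a b c"
  shows "(\<forall>y\<in>graph_line a b c \<alpha> \<rho> \<kappa>. normal_cubic m y = 0) \<longleftrightarrow> (\<alpha>, \<rho>, \<kappa>) \<in> line_params m"
proof -
  have nf: "normal_cubic m y = y $ 4 * ((\<alpha>\<^sup>2 + \<kappa>\<^sup>2 - m) * (y $ 4)\<^sup>2 + 2 * (\<kappa> * (\<rho> + \<alpha>)) * y $ 4 * y $ b
      + (1 + \<rho>\<^sup>2 + 2 * \<alpha> * \<rho>) * (y $ b)\<^sup>2)" if "y \<in> graph_line a b c \<alpha> \<rho> \<kappa>" for y
    using that unfolding normal_cubic_frame[OF f] graph_line_def
    by (simp add: algebra_simps power2_eq_square power3_eq_cube)
  show ?thesis
  proof
    assume v: "\<forall>y\<in>graph_line a b c \<alpha> \<rho> \<kappa>. normal_cubic m y = 0"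
    let ?u = "graph_point a c \<alpha> \<kappa>" and ?v = "graph_dir b c \<rho>"
    have ev: "(\<alpha>\<^sup>2 + \<kappa>\<^sup>2 - m) + 2 * (\<kappa> * (\<rho> + \<alpha>)) * s + (1 + \<rho>\<^sup>2 + 2 * \<alpha> * \<rho>) * s\<^sup>2 = 0" for s
    proof -
      have i: "?u + s *\<^sub>R ?v \<in> graph_line a b c \<alpha> \<rho> \<kappa>"
        using graph_point_dir_in[OF f] subspace_graph_line by (intro subspace_add subspace_scale) auto
      have e: "(?u + s *\<^sub>R ?v) $ 4 = 1" "(?u + s *\<^sub>R ?v) $ b = s"
        using frame_distinct[OF f] by (auto simp: graph_point_def graph_dir_def)
      show ?thesis using nf[OF i] v i unfolding e by simp
    qed
    show "(\<alpha>, \<rho>, \<kappa>) \<in> line_params m"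
      using ev[of 0] ev[of 1] ev[of "-1"] unfolding line_params_def by simp
  qed (simp add: nf line_params_def)
qed

lemma line_params_rho: "(\<alpha>, \<rho>, \<kappa>) \<in> line_params m \<Longrightarrow> \<rho> \<noteq> 0"
  by (auto simp: line_params_def)

text \<open>The first equation says \<open>(\<rho> + \<alpha>)\<^sup>2 = \<alpha>\<^sup>2 - 1\<close>, so \<open>\<alpha>\<^sup>2 \<ge> 1\<close>, while the last one gives
  \<open>\<alpha>\<^sup>2 \<le> m\<close>.\<close>

lemma line_params_empty:
  assumes "m < 1" shows "line_params m = {}"
proof -
  have False if "1 + \<rho>\<^sup>2 + 2 * \<alpha> * \<rho> = 0" "\<kappa> * (\<rho> + \<alpha>) = 0" "\<alpha>\<^sup>2 + \<kappa>\<^sup>2 = m" for \<alpha> \<rho> \<kappa> :: real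
  proof -
    have "(\<rho> + \<alpha>)\<^sup>2 = \<alpha>\<^sup>2 - 1" using that(1) by (simp add: power2_sum algebra_simps)
    then have "\<alpha>\<^sup>2 \<ge> 1" using zero_le_power2[of "\<rho> + \<alpha>"] by linarith
    then show False using that(3) assms zero_le_power2[of \<kappa>] by linarith
  qed
  then show ?thesis by (auto simp: line_params_def)
qed

text \<open>The two planes with \<open>\<alpha>\<^sup>2 = m\<close> (where \<open>\<kappa> = 0\<close>) and the two with \<open>\<alpha>\<^sup>2 = 1\<close> (where
  \<open>\<rho> = - \<alpha>\<close>) contain two lines each.\<close>

lemma line_params_8:
  assumes "m > 1" shows "card (line_params m) = 8"
proof -
  define P Q where "P = sqrt m" and "Q = sqrt (m - 1)"
  have PQ: "P > 0" "Q > 0" "P\<^sup>2 = m" "Q\<^sup>2 = m - 1" using assms by (auto simp: P_def Q_def)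
  then have "P\<^sup>2 \<noteq> Q\<^sup>2" by simp
  then have ne: "P \<noteq> Q" by auto
  have "line_params m = {(P, Q - P, 0), (P, - Q - P, 0), (- P, P + Q, 0), (- P, P - Q, 0),
     (1, -1, Q), (1, -1, - Q), (-1, 1, Q), (-1, 1, - Q)}" (is "_ = ?R")
  proof (intro equalityI subsetI)
    fix t assume "t \<in> line_params m"
    then obtain \<alpha> \<rho> \<kappa> where t: "t = (\<alpha>, \<rho>, \<kappa>)" and
      h: "1 + \<rho>\<^sup>2 + 2 * \<alpha> * \<rho> = 0" "\<kappa> * (\<rho> + \<alpha>) = 0" "\<alpha>\<^sup>2 + \<kappa>\<^sup>2 = m"
      by (auto simp: line_params_def)
    have sq: "(\<rho> + \<alpha>)\<^sup>2 = \<alpha>\<^sup>2 - 1" using h(1) by (simp add: power2_sum algebra_simps)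
    show "t \<in> ?R"
    proof (cases "\<kappa> = 0")
      case True
      then have "\<alpha>\<^sup>2 = P\<^sup>2" "(\<rho> + \<alpha>)\<^sup>2 = Q\<^sup>2" using h PQ sq by auto
      then have "(\<alpha> = P \<or> \<alpha> = - P) \<and> (\<rho> + \<alpha> = Q \<or> \<rho> + \<alpha> = - Q)"
        by (simp add: power2_eq_iff)
      then have "(\<alpha> = P \<and> (\<rho> = Q - P \<or> \<rho> = - Q - P)) \<or> (\<alpha> = - P \<and> (\<rho> = P + Q \<or> \<rho> = P - Q))"
        by linarith
      then show ?thesis using True t by auto
    next
      case False
      then have r: "\<rho> = - \<alpha>" using h(2) by simp
      then have "\<alpha>\<^sup>2 = 1" using sq by simp
      moreover from this have "\<kappa>\<^sup>2 = Q\<^sup>2" using h(3) PQ(4) by linarith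
      ultimately have "(\<alpha> = 1 \<or> \<alpha> = - 1) \<and> \<kappa>\<^sup>2 = Q\<^sup>2" by (simp add: power2_eq_1_iff)
      then show ?thesis using t r by (auto simp: power2_eq_iff)
    qed
  next
    fix t assume "t \<in> ?R"
    then show "t \<in> line_params m"
      using PQ by (auto simp: line_params_def power2_eq_square algebra_simps)
  qed
  moreover have "card ?R = 8" using PQ ne by simp
  ultimately show ?thesis by simp
qed

lemma frame_covers: "a \<in> {1, 2, 3} \<Longrightarrow> \<exists>b c. frame a b c"
  by (auto simp: frame_def)

text \<open>On a plane inside \<open>t = 0\<close> the product \<open>y\<^sub>1 y\<^sub>2 y\<^sub>3\<close> vanishes, and therefore one of its factors
  does.  Any other plane contains a vector \<open>v\<close> at infinity with \<open>v\<^sub>a = 0\<close> for some \<open>a\<close>; the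
  quadratic part of the form then forces \<open>v\<^sub>b \<noteq> 0\<close>, and the plane is a graph line.\<close>

lemma real_planes_normal_cubic:
  "real_planes (normal_cubic m) = base_line ` {1, 2, 3} \<union>
     {graph_line a b c \<alpha> \<rho> \<kappa> | a b c \<alpha> \<rho> \<kappa>. frame a b c \<and> (\<alpha>, \<rho>, \<kappa>) \<in> line_params m}"
    (is "_ = ?B \<union> ?G")
proof (intro equalityI subsetI)
  fix U assume "U \<in> real_planes (normal_cubic m)"
  then have U: "subspace U" "dim U = 2" and van: "\<And>y. y \<in> U \<Longrightarrow> normal_cubic m y = 0"
    by (auto simp: real_planes_def)
  show "U \<in> ?B \<union> ?G"
  proof (cases "\<exists>w\<in>U. w $ 4 \<noteq> 0")
    case False
    have "\<exists>a\<in>{1, 2, 3}. \<forall>y\<in>U. y $ a = 0"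
    proof (rule ccontr)
      assume "\<not> ?thesis"
      then obtain x where "x \<in> U" "x $ 1 \<noteq> 0" and ne: "\<exists>y\<in>U. y $ 2 \<noteq> 0" "\<exists>y\<in>U. y $ 3 \<noteq> 0" by auto
      then obtain u v where uv: "u \<in> U" "v \<in> U" "u $ 1 = 1" "v $ 1 = 0" "U = span {u, v}"
        using plane_basis[OF U, of x 1] by metis
      have pr: "y $ 1 * y $ 2 * y $ 3 = 0" if "y \<in> U" for y
        using van[OF that] False that by (auto simp: normal_cubic_def)
      \<comment> \<open>Of the three values \<open>0, 1, -1\<close> of \<open>s\<close>, two make the same factor vanish.\<close>
      have "(u $ 2 + s * v $ 2) * (u $ 3 + s * v $ 3) = 0" for s
        using pr[of "u + s *\<^sub>R v"] uv U(1) by (simp add: subspace_add subspace_scale)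
      from this[of 0] this[of 1] this[of "-1"]
      have "(u $ 2 = 0 \<and> v $ 2 = 0) \<or> (u $ 3 = 0 \<and> v $ 3 = 0)" by auto
      then have "(\<forall>y\<in>U. y $ 2 = 0) \<or> (\<forall>y\<in>U. y $ 3 = 0)"
        unfolding uv(5) by (auto simp: in_span_pair)
      then show False using ne by blast
    qed
    then obtain a where a: "a \<in> {1, 2, 3}" "\<forall>y\<in>U. y $ a = 0" by blast
    then obtain b c where f: "frame a b c" using frame_covers by blast
    have "U \<subseteq> base_line a" using a False by (auto simp: base_line_def)
    then have "U = base_line a"
      using U subspace_base_line dim_base_line[OF f] by (intro subspace_dim_equal) auto
    then show ?thesis using a by blast
  next
    case True
    then obtain u v where uv: "u \<in> U" "v \<in> U" "u $ 4 = 1" "v $ 4 = 0" "v \<noteq> 0" "U = span {u, v}"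
      using plane_basis[OF U] by metis
    have "v $ 1 * v $ 2 * v $ 3 = 0" using van[OF uv(2)] uv by (simp add: normal_cubic_def)
    then obtain a where "a \<in> {1, 2, 3}" and va: "v $ a = 0" by auto
    then obtain b c where f: "frame a b c" using frame_covers by blast
    \<comment> \<open>The second difference extracts the coefficient of \<open>s\<^sup>2\<close> in the form at \<open>u + s v\<close>.\<close>
    have "normal_cubic m (u + v) + normal_cubic m (u - v) - 2 * normal_cubic m u = 0"
      using van uv U(1) by (simp add: subspace_add subspace_diff)
    then have q: "(v $ b)\<^sup>2 + (v $ c)\<^sup>2 + 2 * u $ a * v $ b * v $ c = 0"
      unfolding normal_cubic_frame[OF f] using uv(3,4) va
      by (simp add: algebra_simps power2_eq_square)
    have vb: "v $ b \<noteq> 0"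
    proof
      assume "v $ b = 0"
      then have "v $ c = 0" using q by simp
      then show False using \<open>v $ b = 0\<close> va uv(4,5) by (simp add: vec_eq_frame[OF f])
    qed
    define \<alpha> \<rho> \<kappa> where "\<alpha> = u $ a" and "\<rho> = v $ c / v $ b" and "\<kappa> = u $ c - \<rho> * u $ b"
    have "u \<in> graph_line a b c \<alpha> \<rho> \<kappa>" "v \<in> graph_line a b c \<alpha> \<rho> \<kappa>"
      using uv(3,4) va vb by (auto simp: graph_line_def \<alpha>_def \<rho>_def \<kappa>_def)
    then have "U \<subseteq> graph_line a b c \<alpha> \<rho> \<kappa>"
      unfolding uv(6) by (intro span_minimal subspace_graph_line) auto
    then have eq: "U = graph_line a b c \<alpha> \<rho> \<kappa>"
      using U subspace_graph_line dim_graph_line[OF f] by (intro subspace_dim_equal) auto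
    then have "(\<alpha>, \<rho>, \<kappa>) \<in> line_params m"
      using van graph_line_vanishes[OF f] by blast
    then show ?thesis using f eq by blast
  qed
next
  fix U assume "U \<in> ?B \<union> ?G"
  then consider a where "a \<in> {1, 2, 3}" "U = base_line a"
    | a b c \<alpha> \<rho> \<kappa> where "frame a b c" "(\<alpha>, \<rho>, \<kappa>) \<in> line_params m" "U = graph_line a b c \<alpha> \<rho> \<kappa>"
    by blast
  then show "U \<in> real_planes (normal_cubic m)"
  proof cases
    case 1
    then obtain b c where f: "frame a b c" using frame_covers by blast
    show ?thesis unfolding 1(2) real_planes_def
      using subspace_base_line dim_base_line[OF f]
      by (auto simp: normal_cubic_frame[OF f] base_line_def)
  next
    case 2
    then show ?thesis unfolding real_planes_def
      using subspace_graph_line dim_graph_line graph_line_vanishes by blast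
  qed
qed

text \<open>The point at infinity of a graph line has \<open>y\<^sub>a = 0\<close> and, as \<open>\<rho> \<noteq> 0\<close>, nonzero coordinates
  \<open>y\<^sub>b\<close> and \<open>y\<^sub>c\<close>.  Thus the line determines \<open>a\<close>.\<close>

lemma graph_line_inj:
  assumes f: "frame a b c" "frame a' b' c'" and rho: "\<rho> \<noteq> 0"
    and eq: "graph_line a b c \<alpha> \<rho> \<kappa> = graph_line a' b' c' \<alpha>' \<rho>' \<kappa>'"
  shows "a = a' \<and> b = b' \<and> c = c' \<and> \<alpha> = \<alpha>' \<and> \<rho> = \<rho>' \<and> \<kappa> = \<kappa>'"
proof -
  have u: "graph_point a c \<alpha> \<kappa> \<in> graph_line a' b' c' \<alpha>' \<rho>' \<kappa>'"
    and v: "graph_dir b c \<rho> \<in> graph_line a' b' c' \<alpha>' \<rho>' \<kappa>'"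
    using graph_point_dir_in[OF f(1)] eq by auto
  have "a' = a"
    using v rho frame_distinct[OF f(1)] frame_distinct(4)[OF f(2)] frame_distinct(7)[OF f(1), of a']
    by (auto simp: graph_line_def graph_dir_def)
  then have bc: "b' = b" "c' = c" using f by (auto simp: frame_def)
  show ?thesis using u v frame_distinct[OF f(1)] unfolding \<open>a' = a\<close> bc
    by (auto simp: graph_line_def graph_point_def graph_dir_def)
qed

lemma card_real_planes_normal_cubic:
  assumes "m \<noteq> 1"
  shows "card (real_planes (normal_cubic m)) = (if m > 1 then 27 else 3)"
proof -
  let ?G = "{graph_line a b c \<alpha> \<rho> \<kappa> | a b c \<alpha> \<rho> \<kappa>. frame a b c \<and> (\<alpha>, \<rho>, \<kappa>) \<in> line_params m}"
  let ?g = "\<lambda>((a, b, c), (\<alpha>, \<rho>, \<kappa>)). graph_line a b c \<alpha> \<rho> \<kappa>"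
  let ?I = "{(a, b, c). frame a b c} \<times> line_params m"
  have fin: "finite (line_params m)"
    using assms line_params_empty[of m] line_params_8[of m]
    by (cases "m < 1") (auto intro: card_ge_0_finite)
  have frames: "{(a, b, c). frame a b c} = {(1, 2, 3), (2, 3, 1), (3, 1, 2)}"
    by (auto simp: frame_def)
  have "inj_on ?g ?I"
    by (rule inj_onI) (auto dest: graph_line_inj line_params_rho)
  moreover have G: "?G = ?g ` ?I" by force
  moreover have "card ?I = 3 * card (line_params m)"
    by (simp add: frames card_cartesian_product)
  ultimately have cg: "card ?G = 3 * card (line_params m)"
    by (simp only: card_image)
  have fg: "finite ?G" unfolding G frames using fin by simp
  have ib: "inj_on base_line {1, 2, 3}"
  proof (rule inj_onI)
    fix a a' :: 4 assume a: "a \<in> {1, 2, 3}" "a' \<in> {1, 2, 3}" "base_line a = base_line a'"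
    show "a = a'"
    proof (rule ccontr)
      assume "a \<noteq> a'"
      then have "axis a' 1 \<in> base_line a" using a(1,2) by (auto simp: base_line_def axis_def)
      then have "axis a' 1 \<in> base_line a'" using a(3) by blast
      then show False by (simp add: base_line_def)
    qed
  qed
  have cb: "card (base_line ` {1, 2, 3}) = 3" using card_image[OF ib] by simp
  have "base_line ` {1, 2, 3} \<inter> ?G = {}"
  proof -
    have "base_line a' \<noteq> graph_line a b c \<alpha> \<rho> \<kappa>" if "frame a b c" for a a' b c \<alpha> \<rho> \<kappa>
    proof
      assume "base_line a' = graph_line a b c \<alpha> \<rho> \<kappa>"
      then have "graph_point a c \<alpha> \<kappa> \<in> base_line a'" using graph_point_dir_in(1)[OF that] by blast
      then show False by (simp add: base_line_def graph_point_def)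
    qed
    then show ?thesis by blast
  qed
  then have "card (real_planes (normal_cubic m)) = 3 + 3 * card (line_params m)"
    unfolding real_planes_normal_cubic using cg cb fg by (subst card_Un_disjoint) auto
  then show ?thesis using assms line_params_empty[of m] line_params_8[of m] by auto
qed

section \<open>Reduction to the normal form\<close>

text \<open>The characters of the Klein four-group acting on the coordinates; the factor \<open>k\<close> rescales \<open>t\<close>.\<close>

definition hadamard :: "real \<Rightarrow> real ^ 4 \<Rightarrow> real ^ 4" where
  "hadamard k x = (\<chi> i. if i = 1 then x $ 4 + x $ 1 - x $ 2 - x $ 3
     else if i = 2 then x $ 4 - x $ 1 + x $ 2 - x $ 3
     else if i = 3 then x $ 4 - x $ 1 - x $ 2 + x $ 3
     else k * (x $ 4 + x $ 1 + x $ 2 + x $ 3))"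

lemma linear_hadamard: "linear (hadamard k)"
  by (rule linearI) (auto simp: hadamard_def vec_eq_iff algebra_simps)

lemma inj_hadamard: assumes "k \<noteq> 0" shows "inj (hadamard k)"
  unfolding linear_injective_0[OF linear_hadamard]
proof (intro allI impI)
  fix x assume "hadamard k x = 0"
  then have "x $ 4 + x $ 1 - x $ 2 - x $ 3 = 0" "x $ 4 - x $ 1 + x $ 2 - x $ 3 = 0"
    "x $ 4 - x $ 1 - x $ 2 + x $ 3 = 0" "x $ 4 + x $ 1 + x $ 2 + x $ 3 = 0"
    using assms by (simp_all add: hadamard_def vec_eq_iff forall_4)
  then have "x $ 1 = 0" "x $ 2 = 0" "x $ 3 = 0" "x $ 4 = 0" by linarith+
  then show "x = 0" by (simp add: vec_eq_iff forall_4)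
qed

text \<open>The power sums \<open>p\<^sub>2\<close> and \<open>p\<^sub>3\<close> take a simple form in the new coordinates: up to the factors
  \<open>1/4\<close> and \<open>1/16\<close>, the coefficient of a monomial counts the orderings of its factors as
  characters with trivial product.\<close>

lemma cubic_hadamard:
  fixes a b c :: real
  defines "p \<equiv> 16 * a + 4 * b + c" and "q \<equiv> 4 * b + 3 * c" and "r \<equiv> 3 * c"
  assumes "q \<noteq> 0" "r \<noteq> 0"
  shows "cubic a b c x = r / 16 * normal_cubic (- p * r\<^sup>2 / q ^ 3) (hadamard (q / r) x)"
proof -
  define t y1 y2 y3 where "t = x $ 4 + x $ 1 + x $ 2 + x $ 3" and "y1 = x $ 4 + x $ 1 - x $ 2 - x $ 3"
    and "y2 = x $ 4 - x $ 1 + x $ 2 - x $ 3" and "y3 = x $ 4 - x $ 1 - x $ 2 + x $ 3"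
  note defs = t_def y1_def y2_def y3_def
  have s1: "psum 1 x = t" by (simp add: psum_def sum_4 t_def)
  have s2: "psum 2 x = (t\<^sup>2 + (y1\<^sup>2 + y2\<^sup>2 + y3\<^sup>2)) / 4"
    unfolding psum_def sum_4 defs by (simp add: power2_eq_square algebra_simps)
  have s3: "psum 3 x = (t ^ 3 + 3 * t * (y1\<^sup>2 + y2\<^sup>2 + y3\<^sup>2) + 6 * y1 * y2 * y3) / 16"
    unfolding psum_def sum_4 defs by (simp add: power2_eq_square power3_eq_cube algebra_simps)
  have k: "r * (q / r) = q" "r * (- p * r\<^sup>2 / q ^ 3 * (q / r) ^ 3) = - p"
    using assms(4,5) by (simp_all add: power_divide power2_eq_square power3_eq_cube)
  have "r / 16 * normal_cubic (- p * r\<^sup>2 / q ^ 3) (hadamard (q / r) x)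
      = r / 16 * (q / r * t * (y1\<^sup>2 + y2\<^sup>2 + y3\<^sup>2) - (- p * r\<^sup>2 / q ^ 3) * (q / r * t) ^ 3 + 2 * y1 * y2 * y3)"
    by (simp add: normal_cubic_def hadamard_def defs)
  also have "\<dots> = (r * (q / r) * t * (y1\<^sup>2 + y2\<^sup>2 + y3\<^sup>2)
      - r * (- p * r\<^sup>2 / q ^ 3 * (q / r) ^ 3) * t ^ 3 + 2 * r * y1 * y2 * y3) / 16"
    unfolding power_mult_distrib by (simp only: divide_inverse) (simp add: ring_distribs mult_ac)
  also have "\<dots> = cubic a b c x"
    unfolding k unfolding cubic_def s1 s2 s3 p_def q_def r_def by (simp add: field_simps power2_eq_square power3_eq_cube)
  finally show ?thesis by simp
qed

lemma card_real_planes_cubic: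
  fixes a b c :: real
  defines "p \<equiv> 16 * a + 4 * b + c" and "q \<equiv> 4 * b + 3 * c" and "r \<equiv> 3 * c"
  assumes "q \<noteq> 0" "r \<noteq> 0" "p * r\<^sup>2 + q ^ 3 \<noteq> 0"
  shows "card (real_planes (cubic a b c)) = (if - p * r\<^sup>2 / q ^ 3 > 1 then 27 else 3)"
proof -
  have "card (real_planes (cubic a b c)) = card (real_planes (normal_cubic (- p * r\<^sup>2 / q ^ 3)))"
  proof (rule card_real_planes_linear[OF linear_hadamard inj_hadamard])
    show "q / r \<noteq> 0" "r / 16 \<noteq> 0" using assms(4,5) by simp_all
    show "cubic a b c x = r / 16 * normal_cubic (- p * r\<^sup>2 / q ^ 3) (hadamard (q / r) x)" for x
      using assms(4,5) unfolding p_def q_def r_def by (rule cubic_hadamard)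
  qed
  moreover have "- p * r\<^sup>2 / q ^ 3 \<noteq> 1"
  proof
    assume "- p * r\<^sup>2 / q ^ 3 = 1"
    then have "- p * r\<^sup>2 = q ^ 3" using assms(4) by (subst (asm) divide_eq_1_iff) simp
    then show False using assms(6) by simp
  qed
  ultimately show ?thesis by (simp add: card_real_planes_normal_cubic)
qed

section \<open>Smoothness\<close>

lemma smooth_surface_iff:
  assumes "\<And>z. eval4 (complexify4 F) z = cubic a b c z"
    and "\<And>i z. eval4 (partial4 i (complexify4 F)) z = cubic_partial a b c i z"
  shows "smooth_surface F \<longleftrightarrow> (\<forall>z. z \<noteq> 0 \<longrightarrow> cubic a b c z = 0 \<longrightarrow> (\<exists>i. cubic_partial a b c i z \<noteq> 0))"
    (is "_ \<longleftrightarrow> ?R")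
proof
  assume s: "smooth_surface F"
  show ?R
  proof (intro allI impI)
    fix z :: "complex ^ 4" assume z: "z \<noteq> 0" "cubic a b c z = 0"
    then have "vec.span {z} \<in> surface F" using span_in_surface[OF assms(1)] by blast
    moreover have "z \<in> vec.span {z}" by (simp add: vec.span_base)
    ultimately show "\<exists>i. cubic_partial a b c i z \<noteq> 0"
      using s z unfolding smooth_surface_def assms(2) by blast
  qed
next
  assume ?R
  then show "smooth_surface F" unfolding smooth_surface_def surface_def assms by blast
qed

definition vec4 :: "'a \<Rightarrow> 'a \<Rightarrow> 'a \<Rightarrow> 'a \<Rightarrow> 'a ^ 4" where
  "vec4 s t u v = (\<chi> i. if i = 1 then s else if i = 2 then t else if i = 3 then u else v)"

lemma vec4_nth [simp]:
  "vec4 s t u v $ 1 = s" "vec4 s t u v $ 2 = t" "vec4 s t u v $ 3 = u" "vec4 s t u v $ 4 = v"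
  by (simp_all add: vec4_def)

text \<open>Each degenerate case has an explicit singular point.  If \<open>c = 0\<close>, the form is divisible by
  \<open>p\<^sub>1\<close>, and \<open>(1, -1, \<i>, -\<i>)\<close> lies on both components.  If \<open>q = 0\<close>, the point
  \<open>(1, -1, 1, -1)\<close> is singular, where two of the three lines in the plane \<open>p\<^sub>1 = 0\<close> meet.
  In the last case the singular point is \<open>(t, y\<^sub>1, y\<^sub>2, y\<^sub>3) = (r, q, q, - q)\<close> up to scaling,
  the node of the normal form for \<open>m = 1\<close>.\<close>

lemma smooth_cubic_nondegenerate:
  fixes a b c :: complex
  defines "p \<equiv> 16 * a + 4 * b + c" and "q \<equiv> 4 * b + 3 * c" and "r \<equiv> 3 * c"
  assumes smooth: "\<And>z. z \<noteq> 0 \<Longrightarrow> cubic a b c z = 0 \<Longrightarrow> \<exists>i. cubic_partial a b c i z \<noteq> 0"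
  shows "r \<noteq> 0" "q \<noteq> 0" "p * r\<^sup>2 + q ^ 3 \<noteq> 0"
proof -
  have sing: False if "z \<noteq> 0" "cubic a b c z = 0" "\<forall>i. cubic_partial a b c i z = 0" for z
    using smooth that by blast
  show "r \<noteq> 0"
  proof
    assume "r = 0"
    then show False
      by (intro sing[of "vec4 1 (-1) \<i> (-\<i>)"])
         (simp_all add: r_def cubic_def cubic_partial_def psum_def sum_4 forall_4 vec_eq_iff power3_eq_cube)
  qed
  show q: "q \<noteq> 0"
  proof
    assume "q = 0"
    then show False
      by (intro sing[of "vec4 1 (-1) 1 (-1)"])
         (simp_all add: q_def cubic_def cubic_partial_def psum_def sum_4 forall_4 vec_eq_iff mult.commute)
  qed
  show "p * r\<^sup>2 + q ^ 3 \<noteq> 0"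
  proof
    assume d: "p * r\<^sup>2 + q ^ 3 = 0"
    let ?z = "vec4 (r + q) (r + q) (r - 3 * q) (r + q)"
    have "cubic a b c ?z = 4 * r * (p * r\<^sup>2 + q ^ 3)"
      unfolding cubic_def psum_def sum_4 vec4_nth p_def q_def r_def
      by (simp add: algebra_simps power2_eq_square power3_eq_cube)
    moreover have "\<forall>i. cubic_partial a b c i ?z = 3 * (p * r\<^sup>2 + q ^ 3)"
      unfolding cubic_partial_def psum_def sum_4 forall_4 vec4_nth p_def q_def r_def
      by (simp add: algebra_simps power2_eq_square power3_eq_cube)
    moreover have "?z \<noteq> 0"
    proof
      assume "?z = 0"
      from arg_cong[OF this, of "\<lambda>z. z $ 1 - z $ 3"] have "4 * q = 0" by simp
      then show False using q by simp
    qed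
    ultimately show False using d by (intro sing[of ?z]) simp_all
  qed
qed

section \<open>Counting the real lines\<close>

lemma card_real_lines_smooth:
  assumes "smooth_real_symmetric_cubic F"
  shows "card (real_lines F) = 3 \<or> card (real_lines F) = 27"
proof -
  obtain a b c where F: "\<And>z. eval4 (complexify4 F) z = cubic (of_real a) (of_real b) (of_real c) z"
    "\<And>i z. eval4 (partial4 i (complexify4 F)) z = cubic_partial (of_real a) (of_real b) (of_real c) i z"
    using symmetric_cubic_cases assms unfolding smooth_real_symmetric_cubic_def by metis
  let ?p = "16 * a + 4 * b + c" and ?q = "4 * b + 3 * c" and ?r = "3 * c"
  have "complex_of_real ?r \<noteq> 0" "complex_of_real ?q \<noteq> 0" "complex_of_real (?p * ?r\<^sup>2 + ?q ^ 3) \<noteq> 0"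
    using smooth_cubic_nondegenerate[of "of_real a" "of_real b" "of_real c"] assms
    unfolding smooth_real_symmetric_cubic_def smooth_surface_iff[OF F] by simp_all
  then have "?q \<noteq> 0" "?r \<noteq> 0" "?p * ?r\<^sup>2 + ?q ^ 3 \<noteq> 0" unfolding of_real_eq_0_iff by blast+
  from card_real_planes_cubic[OF this] show ?thesis
    unfolding card_real_lines[OF F(1)] by simp
qed

lemma fermat_cubic: "smooth_real_symmetric_cubic (cubic_poly 0 0 1)"
  "card (real_lines (cubic_poly 0 0 1)) = 3"
proof -
  show "smooth_real_symmetric_cubic (cubic_poly 0 0 1)"
    unfolding smooth_real_symmetric_cubic_def smooth_surface_iff[OF complexify4_cubic_poly]
    by (auto simp: homogeneous4_cubic_poly symmetric4_cubic_poly cubic_partial_def vec_eq_iff)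
  show "card (real_lines (cubic_poly 0 0 1)) = 3"
    unfolding card_real_lines[OF complexify4_cubic_poly(1)]
    by (subst card_real_planes_cubic) simp_all
qed

text \<open>This is \<open>\<Sum> x\<^sub>i\<^sup>3 = (\<Sum> x\<^sub>i)\<^sup>3\<close>.  At a singular point each coordinate is \<open>\<plusminus> \<Sum> x\<^sub>i\<close>, and a sum of
  four signs is even, hence not \<open>1\<close>.\<close>

lemma clebsch_cubic: "smooth_real_symmetric_cubic (cubic_poly (-1) 0 1)"
  "card (real_lines (cubic_poly (-1) 0 1)) = 27"
proof -
  have "z = 0" if "\<forall>i. cubic_partial (-1) 0 1 i z = 0" for z :: "complex ^ 4"
  proof -
    have "z $ i = psum 1 z \<or> z $ i = - psum 1 z" for i
      using that by (simp add: cubic_partial_def power2_eq_iff[symmetric])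
    then have "\<exists>e\<in>{1, -1}. z $ i = e * psum 1 z" for i by auto
    then obtain e where e: "\<And>i. e i \<in> {1, -1}" "\<And>i. z $ i = e i * psum 1 z" by metis
    have "psum 1 z = z $ 1 + z $ 2 + z $ 3 + z $ 4" by (simp add: psum_def sum_4)
    then have "(e 1 + e 2 + e 3 + e 4 - 1) * psum 1 z = 0"
      unfolding e(2)[of 1] e(2)[of 2] e(2)[of 3] e(2)[of 4] by (simp add: algebra_simps)
    moreover have "e 1 + e 2 + e 3 + e 4 \<noteq> 1" using e(1)[of 1] e(1)[of 2] e(1)[of 3] e(1)[of 4] by auto
    ultimately have "psum 1 z = 0" by simp
    then show "z = 0" using e(2) by (simp add: vec_eq_iff)
  qed
  then show "smooth_real_symmetric_cubic (cubic_poly (-1) 0 1)"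
    unfolding smooth_real_symmetric_cubic_def smooth_surface_iff[OF complexify4_cubic_poly]
    by (auto simp: homogeneous4_cubic_poly symmetric4_cubic_poly)
  show "card (real_lines (cubic_poly (-1) 0 1)) = 27"
    unfolding card_real_lines[OF complexify4_cubic_poly(1)]
    by (subst card_real_planes_cubic) simp_all
qed

theorem theorem1p3:
  "(\<forall>F. smooth_real_symmetric_cubic F \<longrightarrow> card (real_lines F) = 3 \<or> card (real_lines F) = 27)
   \<and> (\<exists>F. smooth_real_symmetric_cubic F \<and> card (real_lines F) = 3)
   \<and> (\<exists>F. smooth_real_symmetric_cubic F \<and> card (real_lines F) = 27)"
  using card_real_lines_smooth fermat_cubic clebsch_cubic by blast

end
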